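(* Let $G=(V,E)$ be a finite connected multigraph without self-loops, let $\Gamma\subset 2^E$ be a nonempty family of objects, and let $E=E_1\cup E_2$ be a partition of $E$ into two nonempty disjoint subsets that divides $\Gamma$. Let $\Gamma_i=\{\gamma\cap E_i:\gamma\in\Gamma\}$, $i=1,2$. Then: 1. $\mathrm{MEO}(\Gamma)=\mathrm{MEO}(\Gamma_1)+\mathrm{MEO}(\Gamma_2)$; 2. a pmf $\mu\in\mathcal{P}(\Gamma)$ is optimal for $\mathrm{MEO}(\Gamma)$ if and only if its marginal pmfs $\mu_i\in\mathcal{P}(\Gamma_i)$, $i=1,2$, are optimal for $\mathrm{MEO}(\Gamma_i)$, respectively; 3. conversely, given two pmfs $\nu_i\in\mathcal{P}(\Gamma_i)$ that are optimal for $\mathrm{MEO}(\Gamma_i)$, $i=1,2$, the product $\nu_1\oplus\nu_2$ is an optimal pmf in $\mathcal{P}(\Gamma)$ for $\mathrm{MEO}(\Gamma)$; 4. for any pmf $\mu\in\mathcal{P}(\Gamma)$ with marginals $\mu_1,\mu_2$, if $e\in E_i$ ($i=1,2$), then $\mathbb{P}_\mu(e\in\underline{\gamma})=\mathbb{P}_{\mu_i}(e\in\underline{\gamma_i})$.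
   Context: For a nonempty family $\Gamma\subset 2^E$, $\mathcal{P}(\Gamma)$ is the set of probability mass functions (pmfs) on $\Gamma$, and $\mathrm{MEO}(\Gamma)=\min_{\mu\in\mathcal{P}(\Gamma)}\sum_{\gamma,\gamma'\in\Gamma}|\gamma\cap\gamma'|\,\mu(\gamma)\mu(\gamma')$; a pmf attaining the minimum is called optimal for $\mathrm{MEO}(\Gamma)$. For $\mu\in\mathcal{P}(\Gamma)$, $\mathbb{P}_\mu(e\in\underline{\gamma})=\sum_{\gamma\in\Gamma,\,e\in\gamma}\mu(\gamma)$. The partition $\{E_1,E_2\}$ divides $\Gamma$ if $\Gamma=\{\gamma_1\cup\gamma_2:\gamma_1\in\Gamma_1,\gamma_2\in\Gamma_2\}$. The marginals of $\mu\in\mathcal{P}(\Gamma)$ are $\mu_i(\gamma_i)=\sum_{\gamma\in\Gamma,\,\gamma\cap E_i=\gamma_i}\mu(\gamma)$ for $\gamma_i\in\Gamma_i$. The product (trivial coupling) is $(\nu_1\oplus\nu_2)(S)=\nu_1(S\cap E_1)\,\nu_2(S\cap E_2)$ for $S\in 2^E$, where each $\nu_i$ is extended by zero to $2^{E_i}$. *)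

theory Defs
  imports "HOL-Probability.Probability"
begin

text \<open>Edges form an abstract set and \<open>ends\<close> sends each edge to its two endpoints, so
  parallel edges are allowed; two distinct endpoints exclude self-loops.\<close>

locale connected_loopfree_multigraph =
  fixes V :: "'v set" and E :: "'e set" and ends :: "'e \<Rightarrow> 'v set"
  assumes finite_V: "finite V" and V_nonempty: "V \<noteq> {}" and finite_E: "finite E"
    and ends: "e \<in> E \<Longrightarrow> ends e \<subseteq> V \<and> card (ends e) = 2"
    and connected: "u \<in> V \<Longrightarrow> v \<in> V \<Longrightarrow> (u, v) \<in> {(x, y). \<exists>e\<in>E. ends e = {x, y}}\<^sup>*"

definition pmfs_on :: "'e set set \<Rightarrow> 'e set pmf set" where
  "pmfs_on \<Gamma> = {\<mu>. set_pmf \<mu> \<subseteq> \<Gamma>}"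

definition expected_overlap :: "'e set set \<Rightarrow> 'e set pmf \<Rightarrow> real" where
  "expected_overlap \<Gamma> \<mu> =
     (\<Sum>\<gamma>\<in>\<Gamma>. \<Sum>\<gamma>'\<in>\<Gamma>. real (card (\<gamma> \<inter> \<gamma>')) * pmf \<mu> \<gamma> * pmf \<mu> \<gamma>')"

text \<open>\<open>LEAST\<close> is a minimum, not an infimum; \<open>MEO_attained\<close> and \<open>MEO_le\<close> below show that it
  exists whenever \<open>\<Gamma>\<close> is finite and nonempty.\<close>

definition MEO :: "'e set set \<Rightarrow> real" where
  "MEO \<Gamma> = (LEAST m. m \<in> expected_overlap \<Gamma> ` pmfs_on \<Gamma>)"

definition MEO_optimal :: "'e set set \<Rightarrow> 'e set pmf \<Rightarrow> bool" where
  "MEO_optimal \<Gamma> \<mu> \<longleftrightarrow> \<mu> \<in> pmfs_on \<Gamma> \<and> expected_overlap \<Gamma> \<mu> = MEO \<Gamma>"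

definition edge_prob :: "'e set set \<Rightarrow> 'e set pmf \<Rightarrow> 'e \<Rightarrow> real" where
  "edge_prob \<Gamma> \<mu> e = (\<Sum>\<gamma>\<in>{\<gamma>\<in>\<Gamma>. e \<in> \<gamma>}. pmf \<mu> \<gamma>)"

definition restrict_family :: "'e set \<Rightarrow> 'e set set \<Rightarrow> 'e set set" where
  "restrict_family A \<Gamma> = (\<lambda>\<gamma>. \<gamma> \<inter> A) ` \<Gamma>"

definition divides :: "'e set \<Rightarrow> 'e set \<Rightarrow> 'e set set \<Rightarrow> bool" where
  "divides A B \<Gamma> \<longleftrightarrow>
     \<Gamma> = {\<gamma>\<^sub>1 \<union> \<gamma>\<^sub>2 | \<gamma>\<^sub>1 \<gamma>\<^sub>2. \<gamma>\<^sub>1 \<in> restrict_family A \<Gamma> \<and> \<gamma>\<^sub>2 \<in> restrict_family B \<Gamma>}"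

text \<open>The functions passed to \<^const>\<open>embed_pmf\<close> below are genuine pmfs in the intended cases;
  see \<open>pmf_marginal\<close> and \<open>pmf_trivial_coupling\<close>.\<close>

definition marginal :: "'e set set \<Rightarrow> 'e set \<Rightarrow> 'e set pmf \<Rightarrow> 'e set pmf" where
  "marginal \<Gamma> A \<mu> = embed_pmf (\<lambda>\<delta>. \<Sum>\<gamma>\<in>{\<gamma>\<in>\<Gamma>. \<gamma> \<inter> A = \<delta>}. pmf \<mu> \<gamma>)"

text \<open>The product lives on the subsets of \<open>A \<union> B\<close>, hence the value \<open>0\<close> on all other sets.\<close>

definition trivial_coupling ::
    "'e set \<Rightarrow> 'e set \<Rightarrow> 'e set pmf \<Rightarrow> 'e set pmf \<Rightarrow> 'e set pmf" where
  "trivial_coupling A B \<nu>\<^sub>1 \<nu>\<^sub>2 =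
     embed_pmf (\<lambda>S. if S \<subseteq> A \<union> B then pmf \<nu>\<^sub>1 (S \<inter> A) * pmf \<nu>\<^sub>2 (S \<inter> B) else 0)"

lemma embed_pmf_pmf: "embed_pmf (pmf p) = p"
  by (rule type_definition.Rep_inverse[OF td_pmf_embed_pmf])

lemma pmf_map_pmf_Int:
  assumes "finite \<Gamma>" "\<mu> \<in> pmfs_on \<Gamma>"
  shows "pmf (map_pmf (\<lambda>\<gamma>. \<gamma> \<inter> A) \<mu>) \<delta> = (\<Sum>\<gamma>\<in>{\<gamma>\<in>\<Gamma>. \<gamma> \<inter> A = \<delta>}. pmf \<mu> \<gamma>)"
proof -
  have "pmf (map_pmf (\<lambda>\<gamma>. \<gamma> \<inter> A) \<mu>) \<delta> = measure_pmf.prob \<mu> ((\<lambda>\<gamma>. \<gamma> \<inter> A) -` {\<delta>})"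
    by (rule pmf_map)
  also have "\<dots> = measure_pmf.prob \<mu> {\<gamma>\<in>\<Gamma>. \<gamma> \<inter> A = \<delta>}"
    using assms by (intro measure_pmf.finite_measure_eq_AE)
      (auto simp: AE_measure_pmf_iff pmfs_on_def)
  also have "\<dots> = (\<Sum>\<gamma>\<in>{\<gamma>\<in>\<Gamma>. \<gamma> \<inter> A = \<delta>}. pmf \<mu> \<gamma>)"
    using assms by (intro measure_measure_pmf_finite) auto
  finally show ?thesis .
qed

lemma marginal_eq_map_pmf:
  assumes "finite \<Gamma>" "\<mu> \<in> pmfs_on \<Gamma>"
  shows "marginal \<Gamma> A \<mu> = map_pmf (\<lambda>\<gamma>. \<gamma> \<inter> A) \<mu>"
  unfolding marginal_def pmf_map_pmf_Int[OF assms, symmetric] by (rule embed_pmf_pmf)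

lemma pmf_marginal:
  assumes "finite \<Gamma>" "\<mu> \<in> pmfs_on \<Gamma>"
  shows "pmf (marginal \<Gamma> A \<mu>) \<delta> = (\<Sum>\<gamma>\<in>{\<gamma>\<in>\<Gamma>. \<gamma> \<inter> A = \<delta>}. pmf \<mu> \<gamma>)"
  by (simp only: marginal_eq_map_pmf[OF assms] pmf_map_pmf_Int[OF assms])

lemma pmf_map_union_pair_pmf:
  assumes "A \<inter> B = {}" "\<nu>\<^sub>1 \<in> pmfs_on (Pow A)" "\<nu>\<^sub>2 \<in> pmfs_on (Pow B)"
  shows "pmf (map_pmf (\<lambda>(x, y). x \<union> y) (pair_pmf \<nu>\<^sub>1 \<nu>\<^sub>2)) S =
    (if S \<subseteq> A \<union> B then pmf \<nu>\<^sub>1 (S \<inter> A) * pmf \<nu>\<^sub>2 (S \<inter> B) else 0)"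
proof -
  have sub: "x \<subseteq> A" "y \<subseteq> B" if "x \<in> set_pmf \<nu>\<^sub>1" "y \<in> set_pmf \<nu>\<^sub>2" for x y
    using that assms by (auto simp: pmfs_on_def)
  have "pmf (map_pmf (\<lambda>(x, y). x \<union> y) (pair_pmf \<nu>\<^sub>1 \<nu>\<^sub>2)) S =
      measure_pmf.prob (pair_pmf \<nu>\<^sub>1 \<nu>\<^sub>2) ((\<lambda>(x, y). x \<union> y) -` {S})"
    by (rule pmf_map)
  also have "\<dots> = measure_pmf.prob (pair_pmf \<nu>\<^sub>1 \<nu>\<^sub>2)
      (if S \<subseteq> A \<union> B then {(S \<inter> A, S \<inter> B)} else {})"
  proof (intro measure_pmf.finite_measure_eq_AE)
    have "(x \<union> y = S) = ((x, y) \<in> (if S \<subseteq> A \<union> B then {(S \<inter> A, S \<inter> B)} else {}))"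
      if "x \<in> set_pmf \<nu>\<^sub>1" "y \<in> set_pmf \<nu>\<^sub>2" for x y
      using sub[OF that] assms(1) by (simp split: if_split) blast
    then show "AE x in measure_pmf (pair_pmf \<nu>\<^sub>1 \<nu>\<^sub>2). (x \<in> (\<lambda>(x, y). x \<union> y) -` {S}) =
        (x \<in> (if S \<subseteq> A \<union> B then {(S \<inter> A, S \<inter> B)} else {}))"
      by (simp add: AE_measure_pmf_iff)
  qed auto
  also have "\<dots> = (if S \<subseteq> A \<union> B then pmf \<nu>\<^sub>1 (S \<inter> A) * pmf \<nu>\<^sub>2 (S \<inter> B) else 0)"
    by (simp add: measure_pmf_single pmf_pair)
  finally show ?thesis .
qed

lemma trivial_coupling_eq_map_pmf:
  assumes "A \<inter> B = {}" "\<nu>\<^sub>1 \<in> pmfs_on (Pow A)" "\<nu>\<^sub>2 \<in> pmfs_on (Pow B)"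
  shows "trivial_coupling A B \<nu>\<^sub>1 \<nu>\<^sub>2 = map_pmf (\<lambda>(x, y). x \<union> y) (pair_pmf \<nu>\<^sub>1 \<nu>\<^sub>2)"
  unfolding trivial_coupling_def pmf_map_union_pair_pmf[OF assms, symmetric]
  by (rule embed_pmf_pmf)

lemma pmf_trivial_coupling:
  assumes "A \<inter> B = {}" "\<nu>\<^sub>1 \<in> pmfs_on (Pow A)" "\<nu>\<^sub>2 \<in> pmfs_on (Pow B)"
  shows "pmf (trivial_coupling A B \<nu>\<^sub>1 \<nu>\<^sub>2) S =
    (if S \<subseteq> A \<union> B then pmf \<nu>\<^sub>1 (S \<inter> A) * pmf \<nu>\<^sub>2 (S \<inter> B) else 0)"
  by (simp only: trivial_coupling_eq_map_pmf[OF assms] pmf_map_union_pair_pmf[OF assms])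

lemma expected_overlap_has_minimum:
  assumes "finite \<Gamma>" "\<Gamma> \<noteq> {}"
  shows "\<exists>\<mu>\<in>pmfs_on \<Gamma>. \<forall>\<nu>\<in>pmfs_on \<Gamma>. expected_overlap \<Gamma> \<mu> \<le> expected_overlap \<Gamma> \<nu>"
proof -
  define K :: "('a set \<Rightarrow> real) set" where
    "K = PiE UNIV (\<lambda>\<gamma>. if \<gamma> \<in> \<Gamma> then {0..1} else {0})"
  define S where "S = K \<inter> {f. sum f \<Gamma> = 1}"
  define g :: "('a set \<Rightarrow> real) \<Rightarrow> real" where
    "g f = (\<Sum>\<gamma>\<in>\<Gamma>. \<Sum>\<gamma>'\<in>\<Gamma>. real (card (\<gamma> \<inter> \<gamma>')) * f \<gamma> * f \<gamma>')" for f
  have coord: "continuous_on UNIV (\<lambda>f :: 'a set \<Rightarrow> real. f \<gamma>)" for \<gamma>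
    by (rule continuous_on_product_coordinates)
  have "compactin (product_topology (\<lambda>_. euclidean) UNIV) K"
    unfolding K_def by (auto simp: compactin_PiE)
  then have "compact K"
    by (simp add: euclidean_product_topology)
  moreover have "closed {f :: 'a set \<Rightarrow> real. sum f \<Gamma> = 1}"
    by (intro closed_Collect_eq continuous_intros coord)
  ultimately have "compact S"
    unfolding S_def by (rule compact_Int_closed)
  have pmf_S: "pmf \<nu> \<in> S" if "\<nu> \<in> pmfs_on \<Gamma>" for \<nu>
    using that assms sum_pmf_eq_1[of \<Gamma> \<nu>]
    by (auto simp: S_def K_def pmfs_on_def pmf_le_1 set_pmf_iff split: if_splits)
  have S_pmf: "\<exists>\<nu>\<in>pmfs_on \<Gamma>. pmf \<nu> = f" if "f \<in> S" for f
  proof -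
    have pos: "0 \<le> f \<gamma>" and zero: "\<gamma> \<notin> \<Gamma> \<Longrightarrow> f \<gamma> = 0" for \<gamma>
      using that PiE_mem[of f UNIV "\<lambda>\<gamma>. if \<gamma> \<in> \<Gamma> then {0..1} else {0}" \<gamma>]
      by (auto simp: S_def K_def split: if_splits)
    have "(\<integral>\<^sup>+x. ennreal (f x) \<partial>count_space UNIV) = (\<Sum>x\<in>\<Gamma>. ennreal (f x))"
      using assms zero by (intro nn_integral_count_space') auto
    also have "\<dots> = 1"
      using that pos by (simp add: sum_ennreal S_def)
    finally have int: "(\<integral>\<^sup>+x. ennreal (f x) \<partial>count_space UNIV) = 1" .
    have eq: "pmf (embed_pmf f) = f"
      using pmf_embed_pmf[OF pos int] by auto
    then have "embed_pmf f \<in> pmfs_on \<Gamma>"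
      using zero by (force simp: pmfs_on_def set_pmf_iff)
    with eq show ?thesis by blast
  qed
  obtain \<gamma> where "\<gamma> \<in> \<Gamma>" using assms by blast
  then have "pmf (return_pmf \<gamma>) \<in> S"
    by (intro pmf_S) (simp add: pmfs_on_def)
  then have "S \<noteq> {}" by blast
  moreover have "continuous_on S g"
    unfolding g_def
    by (intro continuous_intros continuous_on_subset[OF coord]) auto
  ultimately obtain f where f: "f \<in> S" "\<forall>h\<in>S. g f \<le> g h"
    using continuous_attains_inf[OF \<open>compact S\<close>] by blast
  obtain \<mu> where "\<mu> \<in> pmfs_on \<Gamma>" "pmf \<mu> = f"
    using S_pmf f by blast
  moreover have "expected_overlap \<Gamma> \<nu> = g (pmf \<nu>)" for \<nu>
    by (simp add: expected_overlap_def g_def)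
  ultimately show ?thesis
    using f pmf_S by (intro bexI[of _ \<mu>]) auto
qed

lemma
  assumes "finite \<Gamma>" "\<Gamma> \<noteq> {}"
  shows MEO_attained: "\<exists>\<mu>\<in>pmfs_on \<Gamma>. expected_overlap \<Gamma> \<mu> = MEO \<Gamma>"
    and MEO_le: "\<nu> \<in> pmfs_on \<Gamma> \<Longrightarrow> MEO \<Gamma> \<le> expected_overlap \<Gamma> \<nu>"
proof -
  obtain \<mu> where \<mu>: "\<mu> \<in> pmfs_on \<Gamma>"
    "\<forall>\<nu>\<in>pmfs_on \<Gamma>. expected_overlap \<Gamma> \<mu> \<le> expected_overlap \<Gamma> \<nu>"
    using expected_overlap_has_minimum[OF assms] by blast
  then have eq: "MEO \<Gamma> = expected_overlap \<Gamma> \<mu>"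
    unfolding MEO_def by (intro Least_equality) auto
  show "\<exists>\<mu>\<in>pmfs_on \<Gamma>. expected_overlap \<Gamma> \<mu> = MEO \<Gamma>"
    using \<mu> eq by auto
  show "\<nu> \<in> pmfs_on \<Gamma> \<Longrightarrow> MEO \<Gamma> \<le> expected_overlap \<Gamma> \<nu>"
    using \<mu> eq by auto
qed

end

theory Submission
  imports Defs
begin

text \<open>
  By linearity, the expected overlap of two independent samples from \<open>\<mu>\<close> is the sum over all
  edges \<open>e\<close> of the probability that both samples contain \<open>e\<close>, that is, the sum of the squares of
  the edge probabilities (\<open>expected_overlap_eq_sum_edge_prob\<close>). Hence it depends on \<open>\<mu>\<close>
  only through its edge probabilities. The event that the sample contains an edge of
  \<open>E\<^sub>i\<close> is determined by the intersection of the sample with \<open>E\<^sub>i\<close>, so edge probabilities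
  pass unchanged to the marginals, and the expected overlap of \<open>\<mu>\<close> is the sum of those of its
  two marginals (\<open>expected_overlap_eq_sum_marginals\<close>), however the marginals are coupled.

  The minimisation of the sum splits into two independent minimisations as soon as
  every pair of pmfs on the two restricted families occurs as the marginals of some
  pmf on \<open>\<Gamma>\<close>. This is where divisibility enters: it makes the trivial coupling of the pair a
  pmf on \<open>\<Gamma>\<close> (\<open>trivial_coupling_mem_pmfs_on\<close>). So the minima add up, and a sum of two terms,
  each
  bounded below by its minimum, equals the sum of the minima exactly when both terms are minimal.
\<close>

lemma restrict_family_subset_Pow: "restrict_family A \<Gamma> \<subseteq> Pow A"
  by (auto simp: restrict_family_def)

lemma finite_restrict_family: "finite \<Gamma> \<Longrightarrow> finite (restrict_family A \<Gamma>)"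
  by (simp add: restrict_family_def)

lemma edge_prob_eq_prob:
  assumes "finite \<Gamma>" "\<mu> \<in> pmfs_on \<Gamma>"
  shows "edge_prob \<Gamma> \<mu> e = measure_pmf.prob \<mu> {\<gamma>. e \<in> \<gamma>}"
proof -
  have "edge_prob \<Gamma> \<mu> e = measure_pmf.prob \<mu> {\<gamma>\<in>\<Gamma>. e \<in> \<gamma>}"
    unfolding edge_prob_def using assms by (intro measure_measure_pmf_finite[symmetric]) auto
  also have "\<dots> = measure_pmf.prob \<mu> {\<gamma>. e \<in> \<gamma>}"
    using assms by (intro measure_pmf.finite_measure_eq_AE)
      (auto simp: AE_measure_pmf_iff pmfs_on_def)
  finally show ?thesis .
qed

lemma marginal_mem_pmfs_on:
  assumes "finite \<Gamma>" "\<mu> \<in> pmfs_on \<Gamma>"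
  shows "marginal \<Gamma> A \<mu> \<in> pmfs_on (restrict_family A \<Gamma>)"
  using assms by (auto simp: marginal_eq_map_pmf pmfs_on_def restrict_family_def)

text \<open>The marginal is the law of \<open>\<gamma> \<inter> A\<close>, and for \<open>e \<in> A\<close> the sets \<open>\<gamma>\<close> and \<open>\<gamma> \<inter> A\<close>
  contain \<open>e\<close> simultaneously.\<close>

lemma edge_prob_marginal:
  assumes "finite \<Gamma>" "\<mu> \<in> pmfs_on \<Gamma>" "e \<in> A"
  shows "edge_prob (restrict_family A \<Gamma>) (marginal \<Gamma> A \<mu>) e = edge_prob \<Gamma> \<mu> e"
proof -
  have "(\<lambda>\<gamma>. \<gamma> \<inter> A) -` {\<gamma>. e \<in> \<gamma>} = {\<gamma>. e \<in> \<gamma>}"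
    using \<open>e \<in> A\<close> by auto
  then have "measure_pmf.prob (marginal \<Gamma> A \<mu>) {\<gamma>. e \<in> \<gamma>} = measure_pmf.prob \<mu> {\<gamma>. e \<in> \<gamma>}"
    by (simp add: marginal_eq_map_pmf[OF assms(1,2)])
  then show ?thesis
    using edge_prob_eq_prob[OF finite_restrict_family[OF assms(1)]
        marginal_mem_pmfs_on[OF assms(1,2)]]
    by (simp add: edge_prob_eq_prob[OF assms(1,2)])
qed

text \<open>Write the overlap \<open>card (\<gamma> \<inter> \<gamma>')\<close> as a sum over \<open>e\<close> of products of the indicators of
  \<open>e \<in> \<gamma>\<close> and \<open>e \<in> \<gamma>'\<close>; after exchanging the sums, the double sum over \<open>\<gamma>\<close> and \<open>\<gamma>'\<close> factors
  for each \<open>e\<close>.\<close>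

lemma expected_overlap_eq_sum_edge_prob:
  assumes "finite A" "\<Gamma> \<subseteq> Pow A"
  shows "expected_overlap \<Gamma> \<mu> = (\<Sum>e\<in>A. (edge_prob \<Gamma> \<mu> e)\<^sup>2)"
proof -
  have fin: "finite \<Gamma>"
    using assms by (meson finite_Pow_iff finite_subset)
  have ep: "edge_prob \<Gamma> \<mu> e = (\<Sum>\<gamma>\<in>\<Gamma>. of_bool (e \<in> \<gamma>) * pmf \<mu> \<gamma>)" for e
    unfolding edge_prob_def using fin by (intro sum.mono_neutral_cong_left) auto
  have card: "real (card (\<gamma> \<inter> \<gamma>')) = (\<Sum>e\<in>A. of_bool (e \<in> \<gamma>) * of_bool (e \<in> \<gamma>'))"
    if "\<gamma> \<in> \<Gamma>" for \<gamma> \<gamma>'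
  proof -
    have "A \<inter> {e. e \<in> \<gamma> \<and> e \<in> \<gamma>'} = \<gamma> \<inter> \<gamma>'"
      using that assms by auto
    then show ?thesis
      using assms by (simp flip: of_bool_conj)
  qed
  have "expected_overlap \<Gamma> \<mu> =
      (\<Sum>\<gamma>\<in>\<Gamma>. \<Sum>\<gamma>'\<in>\<Gamma>. \<Sum>e\<in>A.
        (of_bool (e \<in> \<gamma>) * pmf \<mu> \<gamma>) * (of_bool (e \<in> \<gamma>') * pmf \<mu> \<gamma>'))"
    unfolding expected_overlap_def
    by (intro sum.cong refl) (simp add: card sum_distrib_right sum_distrib_left ac_simps)
  also have "\<dots> = (\<Sum>\<gamma>\<in>\<Gamma>. \<Sum>e\<in>A. \<Sum>\<gamma>'\<in>\<Gamma>.
        (of_bool (e \<in> \<gamma>) * pmf \<mu> \<gamma>) * (of_bool (e \<in> \<gamma>') * pmf \<mu> \<gamma>'))"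
    by (intro sum.cong refl sum.swap)
  also have "\<dots> = (\<Sum>e\<in>A. \<Sum>\<gamma>\<in>\<Gamma>. \<Sum>\<gamma>'\<in>\<Gamma>.
        (of_bool (e \<in> \<gamma>) * pmf \<mu> \<gamma>) * (of_bool (e \<in> \<gamma>') * pmf \<mu> \<gamma>'))"
    by (rule sum.swap)
  also have "\<dots> = (\<Sum>e\<in>A. (edge_prob \<Gamma> \<mu> e)\<^sup>2)"
    unfolding ep power2_eq_square sum_product ..
  finally show ?thesis .
qed

text \<open>The sum of squared edge probabilities splits along the partition of the edges, and each
  part is seen by one marginal alone.\<close>

lemma expected_overlap_eq_sum_marginals:
  assumes "finite A" "finite B" "A \<inter> B = {}" "\<Gamma> \<subseteq> Pow (A \<union> B)" "\<mu> \<in> pmfs_on \<Gamma>"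
  shows "expected_overlap \<Gamma> \<mu> =
    expected_overlap (restrict_family A \<Gamma>) (marginal \<Gamma> A \<mu>) +
    expected_overlap (restrict_family B \<Gamma>) (marginal \<Gamma> B \<mu>)"
proof -
  have fin: "finite \<Gamma>"
    using assms by (meson finite_Pow_iff finite_UnI finite_subset)
  have "expected_overlap (restrict_family C \<Gamma>) (marginal \<Gamma> C \<mu>) =
      (\<Sum>e\<in>C. (edge_prob \<Gamma> \<mu> e)\<^sup>2)" if "finite C" for C
    using expected_overlap_eq_sum_edge_prob[OF that restrict_family_subset_Pow]
    by (simp add: edge_prob_marginal[OF fin assms(5)])
  then show ?thesis
    using assms
    by (simp add: expected_overlap_eq_sum_edge_prob[of "A \<union> B"] sum.union_disjoint)
qed

lemma trivial_coupling_mem_pmfs_on: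
  assumes "A \<inter> B = {}" "divides A B \<Gamma>"
    "\<nu>\<^sub>1 \<in> pmfs_on (restrict_family A \<Gamma>)" "\<nu>\<^sub>2 \<in> pmfs_on (restrict_family B \<Gamma>)"
  shows "trivial_coupling A B \<nu>\<^sub>1 \<nu>\<^sub>2 \<in> pmfs_on \<Gamma>"
proof -
  have sub: "\<nu>\<^sub>1 \<in> pmfs_on (Pow A)" "\<nu>\<^sub>2 \<in> pmfs_on (Pow B)"
    using assms(3,4) restrict_family_subset_Pow unfolding pmfs_on_def by blast+
  have "x \<union> y \<in> \<Gamma>" if "x \<in> set_pmf \<nu>\<^sub>1" "y \<in> set_pmf \<nu>\<^sub>2" for x y
    using that assms(2-4) unfolding divides_def pmfs_on_def by blast
  then show ?thesis
    by (auto simp: trivial_coupling_eq_map_pmf[OF assms(1) sub] pmfs_on_def)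
qed

lemma marginal_trivial_coupling:
  assumes "finite \<Gamma>" "A \<inter> B = {}" "divides A B \<Gamma>"
    "\<nu>\<^sub>1 \<in> pmfs_on (restrict_family A \<Gamma>)" "\<nu>\<^sub>2 \<in> pmfs_on (restrict_family B \<Gamma>)"
  shows "marginal \<Gamma> A (trivial_coupling A B \<nu>\<^sub>1 \<nu>\<^sub>2) = \<nu>\<^sub>1"
    and "marginal \<Gamma> B (trivial_coupling A B \<nu>\<^sub>1 \<nu>\<^sub>2) = \<nu>\<^sub>2"
proof -
  have sub: "\<nu>\<^sub>1 \<in> pmfs_on (Pow A)" "\<nu>\<^sub>2 \<in> pmfs_on (Pow B)"
    using assms(4,5) restrict_family_subset_Pow unfolding pmfs_on_def by blast+
  have marg: "marginal \<Gamma> C (trivial_coupling A B \<nu>\<^sub>1 \<nu>\<^sub>2) =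
      map_pmf (\<lambda>p. (fst p \<union> snd p) \<inter> C) (pair_pmf \<nu>\<^sub>1 \<nu>\<^sub>2)" for C
    unfolding marginal_eq_map_pmf[OF assms(1) trivial_coupling_mem_pmfs_on[OF assms(2-)]]
    by (simp add: trivial_coupling_eq_map_pmf[OF assms(2) sub] pmf.map_comp o_def
        case_prod_unfold)
  have parts: "(fst p \<union> snd p) \<inter> A = fst p" "(fst p \<union> snd p) \<inter> B = snd p"
    if "p \<in> set_pmf (pair_pmf \<nu>\<^sub>1 \<nu>\<^sub>2)" for p
  proof -
    have "fst p \<subseteq> A" "snd p \<subseteq> B"
      using that sub by (auto simp: pmfs_on_def subset_iff)
    then show "(fst p \<union> snd p) \<inter> A = fst p" "(fst p \<union> snd p) \<inter> B = snd p"
      using assms(2) by blast+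
  qed
  have "marginal \<Gamma> A (trivial_coupling A B \<nu>\<^sub>1 \<nu>\<^sub>2) = map_pmf fst (pair_pmf \<nu>\<^sub>1 \<nu>\<^sub>2)"
    unfolding marg by (rule map_pmf_cong[OF refl]) (rule parts)
  then show "marginal \<Gamma> A (trivial_coupling A B \<nu>\<^sub>1 \<nu>\<^sub>2) = \<nu>\<^sub>1"
    by (simp add: map_fst_pair_pmf)
  have "marginal \<Gamma> B (trivial_coupling A B \<nu>\<^sub>1 \<nu>\<^sub>2) = map_pmf snd (pair_pmf \<nu>\<^sub>1 \<nu>\<^sub>2)"
    unfolding marg by (rule map_pmf_cong[OF refl]) (rule parts)
  then show "marginal \<Gamma> B (trivial_coupling A B \<nu>\<^sub>1 \<nu>\<^sub>2) = \<nu>\<^sub>2"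
    by (simp add: map_snd_pair_pmf)
qed

theorem theorem3p3:
  fixes V :: "'v set" and E E\<^sub>1 E\<^sub>2 :: "'e set" and ends :: "'e \<Rightarrow> 'v set"
    and \<Gamma> :: "'e set set"
  assumes "connected_loopfree_multigraph V E ends"
    and "\<Gamma> \<subseteq> Pow E" and "\<Gamma> \<noteq> {}"
    and "E\<^sub>1 \<noteq> {}" and "E\<^sub>2 \<noteq> {}" and "E\<^sub>1 \<inter> E\<^sub>2 = {}" and "E = E\<^sub>1 \<union> E\<^sub>2"
    and "divides E\<^sub>1 E\<^sub>2 \<Gamma>"
  shows "MEO \<Gamma> = MEO (restrict_family E\<^sub>1 \<Gamma>) + MEO (restrict_family E\<^sub>2 \<Gamma>)
    \<and> (\<forall>\<mu>\<in>pmfs_on \<Gamma>. MEO_optimal \<Gamma> \<mu> \<longleftrightarrow>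
          MEO_optimal (restrict_family E\<^sub>1 \<Gamma>) (marginal \<Gamma> E\<^sub>1 \<mu>) \<and>
          MEO_optimal (restrict_family E\<^sub>2 \<Gamma>) (marginal \<Gamma> E\<^sub>2 \<mu>))
    \<and> (\<forall>\<nu>\<^sub>1\<in>pmfs_on (restrict_family E\<^sub>1 \<Gamma>). \<forall>\<nu>\<^sub>2\<in>pmfs_on (restrict_family E\<^sub>2 \<Gamma>).
          MEO_optimal (restrict_family E\<^sub>1 \<Gamma>) \<nu>\<^sub>1 \<and> MEO_optimal (restrict_family E\<^sub>2 \<Gamma>) \<nu>\<^sub>2 \<longrightarrow>
          MEO_optimal \<Gamma> (trivial_coupling E\<^sub>1 E\<^sub>2 \<nu>\<^sub>1 \<nu>\<^sub>2))
    \<and> (\<forall>\<mu>\<in>pmfs_on \<Gamma>.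
          (\<forall>e\<in>E\<^sub>1. edge_prob \<Gamma> \<mu> e = edge_prob (restrict_family E\<^sub>1 \<Gamma>) (marginal \<Gamma> E\<^sub>1 \<mu>) e) \<and>
          (\<forall>e\<in>E\<^sub>2. edge_prob \<Gamma> \<mu> e = edge_prob (restrict_family E\<^sub>2 \<Gamma>) (marginal \<Gamma> E\<^sub>2 \<mu>) e))"
proof -
  let ?\<Gamma>\<^sub>1 = "restrict_family E\<^sub>1 \<Gamma>" and ?\<Gamma>\<^sub>2 = "restrict_family E\<^sub>2 \<Gamma>"
  note disj = \<open>E\<^sub>1 \<inter> E\<^sub>2 = {}\<close> and div = \<open>divides E\<^sub>1 E\<^sub>2 \<Gamma>\<close>
  have "finite E"
    using assms(1) by (rule connected_loopfree_multigraph.finite_E)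
  then have finE: "finite E\<^sub>1" "finite E\<^sub>2" and fin: "finite \<Gamma>"
    using assms(2,7) by (auto intro: finite_subset[of \<Gamma> "Pow E"])
  have fin': "finite ?\<Gamma>\<^sub>1" "finite ?\<Gamma>\<^sub>2" and ne': "?\<Gamma>\<^sub>1 \<noteq> {}" "?\<Gamma>\<^sub>2 \<noteq> {}"
    using fin assms(3) by (auto simp: restrict_family_def)
  note marg = marginal_mem_pmfs_on[OF fin]
  note le = MEO_le[OF fin'(1) ne'(1)] MEO_le[OF fin'(2) ne'(2)]
  have split: "expected_overlap \<Gamma> \<mu> =
      expected_overlap ?\<Gamma>\<^sub>1 (marginal \<Gamma> E\<^sub>1 \<mu>) + expected_overlap ?\<Gamma>\<^sub>2 (marginal \<Gamma> E\<^sub>2 \<mu>)"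
    if "\<mu> \<in> pmfs_on \<Gamma>" for \<mu>
    using expected_overlap_eq_sum_marginals[OF finE disj _ that] assms(2,7) by simp
  have coupling: "trivial_coupling E\<^sub>1 E\<^sub>2 \<nu>\<^sub>1 \<nu>\<^sub>2 \<in> pmfs_on \<Gamma> \<and>
      expected_overlap \<Gamma> (trivial_coupling E\<^sub>1 E\<^sub>2 \<nu>\<^sub>1 \<nu>\<^sub>2) =
        expected_overlap ?\<Gamma>\<^sub>1 \<nu>\<^sub>1 + expected_overlap ?\<Gamma>\<^sub>2 \<nu>\<^sub>2"
    if "\<nu>\<^sub>1 \<in> pmfs_on ?\<Gamma>\<^sub>1" "\<nu>\<^sub>2 \<in> pmfs_on ?\<Gamma>\<^sub>2" for \<nu>\<^sub>1 \<nu>\<^sub>2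
    using trivial_coupling_mem_pmfs_on[OF disj div that]
    by (simp add: split marginal_trivial_coupling[OF fin disj div that])
  have MEO_sum: "MEO \<Gamma> = MEO ?\<Gamma>\<^sub>1 + MEO ?\<Gamma>\<^sub>2"
  proof (rule antisym)
    obtain \<nu>\<^sub>1 \<nu>\<^sub>2 where \<nu>: "\<nu>\<^sub>1 \<in> pmfs_on ?\<Gamma>\<^sub>1" "\<nu>\<^sub>2 \<in> pmfs_on ?\<Gamma>\<^sub>2"
      "expected_overlap ?\<Gamma>\<^sub>1 \<nu>\<^sub>1 = MEO ?\<Gamma>\<^sub>1" "expected_overlap ?\<Gamma>\<^sub>2 \<nu>\<^sub>2 = MEO ?\<Gamma>\<^sub>2"
      using MEO_attained[OF fin'(1) ne'(1)] MEO_attained[OF fin'(2) ne'(2)] by blast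
    then show "MEO \<Gamma> \<le> MEO ?\<Gamma>\<^sub>1 + MEO ?\<Gamma>\<^sub>2"
      using coupling[OF \<nu>(1,2)] MEO_le[OF fin assms(3)] by metis
  next
    obtain \<mu> where \<mu>: "\<mu> \<in> pmfs_on \<Gamma>" "expected_overlap \<Gamma> \<mu> = MEO \<Gamma>"
      using MEO_attained[OF fin assms(3)] by blast
    then show "MEO ?\<Gamma>\<^sub>1 + MEO ?\<Gamma>\<^sub>2 \<le> MEO \<Gamma>"
      using split[OF \<mu>(1)] le(1)[OF marg] le(2)[OF marg] by (metis add_mono)
  qed
  moreover have "MEO_optimal \<Gamma> \<mu> \<longleftrightarrow>
      MEO_optimal ?\<Gamma>\<^sub>1 (marginal \<Gamma> E\<^sub>1 \<mu>) \<and> MEO_optimal ?\<Gamma>\<^sub>2 (marginal \<Gamma> E\<^sub>2 \<mu>)"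
    if "\<mu> \<in> pmfs_on \<Gamma>" for \<mu>
    using that split[OF that] MEO_sum marg[OF that] le(1)[OF marg[OF that]] le(2)[OF marg[OF that]]
    unfolding MEO_optimal_def by auto
  moreover have "MEO_optimal \<Gamma> (trivial_coupling E\<^sub>1 E\<^sub>2 \<nu>\<^sub>1 \<nu>\<^sub>2)"
    if "MEO_optimal ?\<Gamma>\<^sub>1 \<nu>\<^sub>1" "MEO_optimal ?\<Gamma>\<^sub>2 \<nu>\<^sub>2" for \<nu>\<^sub>1 \<nu>\<^sub>2
    using that coupling MEO_sum unfolding MEO_optimal_def by auto
  moreover have "edge_prob \<Gamma> \<mu> e = edge_prob (restrict_family A \<Gamma>) (marginal \<Gamma> A \<mu>) e"
    if "\<mu> \<in> pmfs_on \<Gamma>" "e \<in> A" for \<mu> e A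
    using edge_prob_marginal[OF fin that] by simp
  ultimately show ?thesis
    by blast
qed

end
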